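(* Let $p$ be a positive integer, let $\Lambda>1$ and $M_1^*,\dots,M_{p-1}^*>1$. Let $$f(z)=\prod_{k=0}^{p-1}\big(a_k(z)\big)^{\bar z^k}$$ be a log-$p$-analytic function in $U$ satisfying $f(0)=\lambda_f(0)=1$. Suppose that (i) for each $k\in\{0,1,\dots,p-1\}$, $a_k$ is log-analytic in $U$, $a_k(0)=a_k'(0)=1$, and $A_k(z):=\log a_k(z)$; (ii) $|a_k(z)|\le M_k^*$ for all $z\in U$ and each $k\in\{1,\dots,p-1\}$, and $|A_0'(z)|<\Lambda$ for all $z\in U$. Put $M_k=\log M_k^*+\pi$ for $k\in\{1,\dots,p-1\}$, let $\rho_4$ be the unique root in $(0,1)$ of the equation $$\Lambda\frac{1-\Lambda r}{\Lambda-r}-\sum_{k=1}^{p-1}\Big(M_k-\frac1{M_k}\Big)\frac{r^{k+1}\big(2-r+k(1-r)\big)}{(1-r)^2}-\sum_{k=1}^{p-1}(k+1)r^k=0,$$ and let $$\sigma_4=\Lambda^2\rho_4+(\Lambda^3-\Lambda)\ln\Big(1-\frac{\rho_4}{\Lambda}\Big)-\rho_4^2\Big(\frac{1-\rho_4^{p-1}}{1-\rho_4}\Big)-\sum_{k=1}^{p-1}\Big(M_k-\frac1{M_k}\Big)\frac{\rho_4^{k+2}}{1-\rho_4}.$$ Then $f$ is univalent in $U_{\rho_4}$, and the range $f(U_{\rho_4})$ contains the schlicht disk $U(w_4,r_4)$, where $$w_4=\cosh\sigma_4,\qquad r_4=\sinh\sigma_4.$$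
   Context: For $r>0$, $U_r=\{z\in\mathbb C:|z|<r\}$, $U=U_1$, and $U(w,r)=\{\zeta\in\mathbb C:|\zeta-w|<r\}$. A continuous complex-valued function $F$ on a domain $D$ is poly-analytic of order $p$ if $\partial^pF/\partial\bar z^p=0$ in $D$. A function $f$ is log-$p$-analytic in $D$ if $\log f$ is poly-analytic of order $p$ in $D$; log-analytic means log-$1$-analytic (i.e. $\log f$ is analytic). Here $\log$ is the principal branch, with $\log 1=0$. The power is $(a_k(z))^{\bar z^k}=\exp(\bar z^k\log a_k(z))$, so $\log f=\sum_{k=0}^{p-1}\bar z^kA_k$. For a continuously differentiable $f$, $\lambda_f(z)=\big||f_z(z)|-|f_{\bar z}(z)|\big|$. Univalent means injective. A schlicht disk in $f(U_\rho)$ is a disk that is the univalent image under $f$ of some region in $U_\rho$. Empty sums are $0$. *)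

theory Defs
  imports "HOL-Complex_Analysis.Complex_Analysis"
begin

text \<open>Wirtinger derivatives, expressed through the real Frechet derivative.\<close>

definition d_z :: "(complex \<Rightarrow> complex) \<Rightarrow> complex \<Rightarrow> complex" where
  "d_z F z = (frechet_derivative F (at z) 1 - \<i> * frechet_derivative F (at z) \<i>) / 2"

definition d_zbar :: "(complex \<Rightarrow> complex) \<Rightarrow> complex \<Rightarrow> complex" where
  "d_zbar F z = (frechet_derivative F (at z) 1 + \<i> * frechet_derivative F (at z) \<i>) / 2"

definition lambda_min :: "(complex \<Rightarrow> complex) \<Rightarrow> complex \<Rightarrow> real" where
  "lambda_min F z = \<bar>cmod (d_z F z) - cmod (d_zbar F z)\<bar>"

text \<open>
  The iterated derivative is only meaningful if every earlier one is real differentiable; since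
  \<^const>\<open>frechet_derivative\<close> is total, this is required explicitly. Here
  \<^const>\<open>differentiable\<close> is real differentiability. \<open>D\<close> is meant to be open.
\<close>

definition poly_analytic :: "nat \<Rightarrow> (complex \<Rightarrow> complex) \<Rightarrow> complex set \<Rightarrow> bool" where
  "poly_analytic p F D \<longleftrightarrow>
     continuous_on D F \<and>
     (\<forall>k<p. \<forall>z\<in>D. (d_zbar ^^ k) F differentiable (at z)) \<and>
     (\<forall>z\<in>D. (d_zbar ^^ p) F z = 0)"

text \<open>\<^const>\<open>Ln\<close> is the principal branch. As \<open>Ln 0 = 0\<close> by convention, zeros are excluded explicitly.\<close>

definition log_p_analytic :: "nat \<Rightarrow> (complex \<Rightarrow> complex) \<Rightarrow> complex set \<Rightarrow> bool" where
  "log_p_analytic p f D \<longleftrightarrow>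
     (\<forall>z\<in>D. f z \<noteq> 0) \<and> poly_analytic p (\<lambda>z. Ln (f z)) D"

definition schlicht_disk :: "(complex \<Rightarrow> complex) \<Rightarrow> complex set \<Rightarrow> complex \<Rightarrow> real \<Rightarrow> bool" where
  "schlicht_disk f S w r \<longleftrightarrow>
     (\<exists>G. open G \<and> connected G \<and> G \<noteq> {} \<and> G \<subseteq> S \<and> inj_on f G \<and> f ` G = ball w r)"

definition rho_eqn :: "nat \<Rightarrow> real \<Rightarrow> (nat \<Rightarrow> real) \<Rightarrow> real \<Rightarrow> real" where
  "rho_eqn p \<Lambda> M r =
     \<Lambda> * ((1 - \<Lambda> * r) / (\<Lambda> - r))
     - (\<Sum>k=1..p-1. (M k - 1 / M k) * (r ^ (k+1) * (2 - r + real k * (1 - r)) / (1 - r)\<^sup>2))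
     - (\<Sum>k=1..p-1. (real k + 1) * r ^ k)"

definition sigma_val :: "nat \<Rightarrow> real \<Rightarrow> (nat \<Rightarrow> real) \<Rightarrow> real \<Rightarrow> real" where
  "sigma_val p \<Lambda> M \<rho> =
     \<Lambda>\<^sup>2 * \<rho> + (\<Lambda> ^ 3 - \<Lambda>) * ln (1 - \<rho> / \<Lambda>)
     - \<rho>\<^sup>2 * ((1 - \<rho> ^ (p-1)) / (1 - \<rho>))
     - (\<Sum>k=1..p-1. (M k - 1 / M k) * (\<rho> ^ (k+2) / (1 - \<rho>)))"

lemma poly_analytic_1_iff_holomorphic:
  assumes "open D"
  shows "poly_analytic 1 F D \<longleftrightarrow> F holomorphic_on D"
proof
  assume P: "poly_analytic 1 F D"
  have "F field_differentiable (at z)" if "z \<in> D" for z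
  proof -
    let ?L = "frechet_derivative F (at z)"
    have d: "(F has_derivative ?L) (at z)"
      using P that by (simp add: poly_analytic_def frechet_derivative_works)
    then interpret bounded_linear ?L by (rule has_derivative_bounded_linear)
    have "?L 1 + \<i> * ?L \<i> = 0" using P that by (simp add: poly_analytic_def d_zbar_def)
    then have i: "?L \<i> = \<i> * ?L 1" by (simp add: complex_eq_iff)
    have "?L h = ?L 1 * h" for h
    proof -
      have "?L h = ?L (Re h *\<^sub>R 1 + Im h *\<^sub>R \<i>)"
        by (rule arg_cong[where f = ?L]) (simp add: complex_eq_iff)
      also have "\<dots> = Re h *\<^sub>R ?L 1 + Im h *\<^sub>R (\<i> * ?L 1)" by (simp only: add scaleR i)
      also have "\<dots> = ?L 1 * h" by (simp add: complex_eq_iff algebra_simps)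
      finally show ?thesis .
    qed
    then have L: "?L = (*) (?L 1)" by (rule ext)
    have "(F has_derivative (*) (?L 1)) (at z)"
      by (rule iffD1[OF arg_cong[where f = "\<lambda>L. (F has_derivative L) (at z)", OF L] d])
    then show ?thesis unfolding field_differentiable_def has_field_derivative_def by (rule exI)
  qed
  then show "F holomorphic_on D"
    by (simp add: holomorphic_on_def field_differentiable_at_within)
next
  assume H: "F holomorphic_on D"
  have d: "(F has_derivative (*) (deriv F z)) (at z)" if "z \<in> D" for z
    using holomorphic_derivI[OF H assms that] by (simp add: has_field_derivative_def)
  have "d_zbar F z = 0" if "z \<in> D" for z
  proof -
    have "frechet_derivative F (at z) = (*) (deriv F z)"
      by (rule frechet_derivative_at[OF d[OF that], symmetric])
    then show ?thesis by (simp add: d_zbar_def complex_eq_iff)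
  qed
  then show "poly_analytic 1 F D"
    using d H by (auto simp: poly_analytic_def differentiable_def holomorphic_on_imp_continuous_on)
qed

end

theory Submission imports Defs begin

text \<open>Put $F = \log f = \sum_k \bar z^k A_k$ and let $E$ be the left-hand side of the equation for
  $\rho_4$, so that $\sigma_4 = \int_0^{\rho_4} E$. Everything follows from
  $\mathrm{Re}\,(\bar h\, DF(z) h) \ge E(|z|)\,|h|^2$: integrated along segments it gives injectivity of
  $F$ on $U_{\rho_4}$ and $|F(z)| \ge \int_0^{|z|} E$, hence $F(U_{\rho_4}) \supseteq U_{\sigma_4}$,
  and $\exp(U_\sigma)$ contains the disk $U(\cosh\sigma, \sinh\sigma)$.

  The term $A_0$ is controlled by the Schwarz lemma for $A_0'/\Lambda$. For $k \ge 1$ the upper bound on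
  $|a_k|$ does not bound $|A_k|$, since $a_k$ may be close to $0$; it only puts $A_k$ into the
  half-strip $\mathrm{Re}\,w \le \log M_k^*$, $|\mathrm{Im}\,w| \le \pi$. As the half-strip is convex,
  the coefficients of $A_k$ are nevertheless at most $\min(4, 2\log M_k^*) \le M_k - 1/M_k$.\<close>

section \<open>Taylor coefficients of functions with values in a half-strip\<close>

text \<open>The Moebius map w / (2L - w) carries the half-plane Re w <= L into the closed unit disk
  and has derivative 1 / (2L) at its fixed point 0, so the Schwarz lemma applies to its composition
  with \<open>g\<close>.\<close>

lemma half_plane_deriv_bound:
  fixes g :: "complex \<Rightarrow> complex"
  assumes holg: "g holomorphic_on ball 0 1" and g0: "g 0 = 0" and "L > 0"
    and Re: "\<And>z. norm z < 1 \<Longrightarrow> Re (g z) \<le> L"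
  shows "norm (deriv g 0) \<le> 2 * L"
proof -
  have ne: "2 * of_real L - g z \<noteq> 0" if "norm z < 1" for z
    using Re[OF that] \<open>L > 0\<close> by (auto simp: complex_eq_iff)
  have dg: "(g has_field_derivative deriv g 0) (at 0)"
    by (rule holomorphic_derivI[OF holg]) auto
  define h where "h = (\<lambda>z. g z / (2 * of_real L - g z))"
  \<comment> \<open>Only \<open>norm (h z) \<le> 1\<close> is known, whereas the Schwarz lemma wants
    a strict bound; the factor \<open>t\<close> supplies it and is sent to 1 at the end.\<close>
  have "t * norm (deriv g 0) \<le> 2 * L" if t: "0 < t" "t < 1" for t :: real
  proof -
    define k where "k = (\<lambda>z. of_real t * h z)"
    have "k holomorphic_on ball 0 1"
      unfolding k_def h_def by (intro holomorphic_intros holg) (use ne in auto)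
    moreover have "k 0 = 0" by (simp add: k_def h_def g0)
    moreover have "norm (k z) < 1" if z: "norm z < 1" for z
    proof -
      have "(norm (g z))\<^sup>2 \<le> (norm (2 * of_real L - g z))\<^sup>2"
        unfolding cmod_power2 using Re[OF z] \<open>L > 0\<close>
        by (simp add: power2_eq_square algebra_simps)
      then have "norm (g z) \<le> norm (2 * of_real L - g z)"
        by (rule power2_le_imp_le) simp
      then have "norm (h z) \<le> 1" using ne[OF z] by (simp add: h_def norm_divide divide_le_eq)
      then have "t * norm (h z) \<le> t * 1" using t by (intro mult_left_mono) auto
      then have "t * norm (h z) < 1" using t by linarith
      then show ?thesis using t by (simp add: k_def norm_mult)
    qed
    ultimately have "norm (deriv k 0) \<le> 1" by (intro Schwarz_Lemma(2)[where \<xi> = 0]) auto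
    moreover have "(k has_field_derivative of_real t * ((deriv g 0 * (2 * of_real L - g 0)
        - g 0 * (0 - deriv g 0)) / ((2 * of_real L - g 0) * (2 * of_real L - g 0)))) (at 0)"
      unfolding k_def h_def
      by (intro DERIV_cmult DERIV_divide DERIV_diff DERIV_const dg) (use ne[of 0] in simp)
    ultimately have "norm (of_real t * (deriv g 0 / (2 * of_real L))) \<le> 1"
      using \<open>L > 0\<close> by (simp add: DERIV_imp_deriv g0)
    then show ?thesis
      using t \<open>L > 0\<close> by (simp add: norm_mult norm_divide divide_le_eq)
  qed
  then show ?thesis by (intro field_le_mult_one_interval[of "norm (deriv g 0)"]) (auto simp: mult.commute)
qed

text \<open>exp(w/2) takes the strip of half-width pi into the closed right half-plane, so 1 -
  exp(w/2) meets the half-plane bound with constant 1; the factor 1/2 in the exponent turns the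
  resulting 2 into 4.\<close>

lemma strip_deriv_bound:
  fixes g :: "complex \<Rightarrow> complex"
  assumes holg: "g holomorphic_on ball 0 1" and g0: "g 0 = 0"
    and Im: "\<And>z. norm z < 1 \<Longrightarrow> \<bar>Im (g z)\<bar> \<le> pi"
  shows "norm (deriv g 0) \<le> 4"
proof -
  define h where "h = (\<lambda>z. 1 - exp (g z / 2))"
  have dg: "(g has_field_derivative deriv g 0) (at 0)"
    by (rule holomorphic_derivI[OF holg]) auto
  have "norm (deriv h 0) \<le> 2 * 1"
  proof (rule half_plane_deriv_bound)
    show "h holomorphic_on ball 0 1"
      unfolding h_def by (intro holomorphic_intros holg) auto
    fix z :: complex assume z: "norm z < 1"
    have "0 \<le> cos (Im (g z) / 2)" using Im[OF z] by (intro cos_ge_zero) auto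
    then show "Re (h z) \<le> 1" by (simp add: h_def Re_exp)
  qed (auto simp: h_def g0)
  moreover have "(h has_field_derivative - (deriv g 0 / 2)) (at 0)"
    unfolding h_def by (auto intro!: derivative_eq_intros dg simp: g0)
  ultimately show ?thesis by (simp add: DERIV_imp_deriv norm_divide)
qed

text \<open>Swapping the two exponents gives a geometric sum in \<open>\<omega> ^ m\<close>, whose
  n-th power is 1: it vanishes unless that number is 1 itself. This is the filter that keeps every
  n-th Taylor coefficient.\<close>

lemma sum_powers_root_of_unity:
  assumes "n > 0"
  defines "\<omega> \<equiv> exp (2 * of_real pi * \<i> / of_nat n)"
  shows "(\<Sum>j<n. (\<omega> ^ j) ^ m) = (if n dvd m then of_nat n else 0)"
proof -
  have pow: "\<omega> ^ m = exp (2 * of_real pi * \<i> * of_nat m / of_nat n)" for m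
    unfolding \<omega>_def exp_of_nat_mult[symmetric] by (simp add: mult_ac)
  have eq: "\<omega> ^ m = 1 \<longleftrightarrow> n dvd m"
    unfolding pow using assms by (intro complex_root_unity_eq_1) auto
  have swap: "(\<Sum>j<n. (\<omega> ^ j) ^ m) = (\<Sum>j<n. (\<omega> ^ m) ^ j)"
    by (simp add: power_mult[symmetric] mult.commute)
  have "(\<omega> ^ m) ^ n = 1"
    using pow[of n] assms by (simp add: power_mult[symmetric] mult.commute[of m] power_mult)
  then show ?thesis unfolding swap using eq by (auto simp: geometric_sum)
qed

text \<open>Rogosinski's averaging: $\frac1n\sum_{j<n} g(\omega^j z)$ is a function of $z^n$ whose linear
  coefficient is the $n$-th coefficient of $g$, and it inherits every convex constraint on the
  values of $g$.\<close>

lemma rogosinski_average: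
  fixes g :: "complex \<Rightarrow> complex"
  assumes holg: "g holomorphic_on ball 0 1" and g0: "g 0 = 0" and "n > 0"
    and "convex S" and gS: "\<And>z. norm z < 1 \<Longrightarrow> g z \<in> S"
  obtains h where "h holomorphic_on ball 0 1" "h 0 = 0"
    "\<And>z. norm z < 1 \<Longrightarrow> h z \<in> S" "deriv h 0 = (deriv ^^ n) g 0 / fact n"
proof -
  define \<omega> where "\<omega> = exp (2 * of_real pi * \<i> / of_nat n)"
  define c where "c = (\<lambda>m. (deriv ^^ m) g 0 / fact m)"
  define av where "av = (\<lambda>z. \<Sum>j<n. (1 / real n) *\<^sub>R g (\<omega> ^ j * z))"
  have norm_\<omega>: "norm \<omega> = 1" by (simp add: \<omega>_def)
  have g_sums: "(\<lambda>m. c m * z ^ m) sums g z" if "norm z < 1" for z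
    using holomorphic_power_series[OF holg, of z] that by (simp add: c_def)
  have av_sums: "(\<lambda>k. c (n * k) * (z ^ n) ^ k) sums av z" if z: "norm z < 1" for z
  proof -
    have "(\<lambda>m. \<Sum>j<n. (1 / real n) *\<^sub>R (c m * (\<omega> ^ j * z) ^ m)) sums av z"
      unfolding av_def by (intro sums_sum sums_scaleR_right g_sums)
        (use z in \<open>simp add: norm_mult norm_power norm_\<omega>\<close>)
    moreover have "(\<Sum>j<n. (1 / real n) *\<^sub>R (c m * (\<omega> ^ j * z) ^ m))
        = (if n dvd m then c m * z ^ m else 0)" for m
    proof -
      have "(\<Sum>j<n. (1 / real n) *\<^sub>R (c m * (\<omega> ^ j * z) ^ m))
          = (1 / real n) *\<^sub>R (c m * z ^ m * (\<Sum>j<n. (\<omega> ^ j) ^ m))"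
        by (simp add: scaleR_sum_right sum_distrib_left power_mult_distrib mult_ac)
      then show ?thesis
        using \<open>n > 0\<close> unfolding \<omega>_def sum_powers_root_of_unity[OF \<open>n > 0\<close>]
        by (simp add: scaleR_conv_of_real)
    qed
    ultimately have "(\<lambda>m. if n dvd m then c m * z ^ m else 0) sums av z" by simp
    moreover have "strict_mono (\<lambda>k. n * k)" using \<open>n > 0\<close> by (simp add: strict_mono_def)
    ultimately have "(\<lambda>k. if n dvd n * k then c (n * k) * z ^ (n * k) else 0) sums av z"
      by (subst sums_mono_reindex[where g = "\<lambda>k. n * k"]) auto
    then show ?thesis by (simp add: power_mult)
  qed
  \<comment> \<open>\<open>h\<close> is \<open>av\<close> in the variable w = z^n. Every w in the
    unit disk has an n-th root there, so both the convergence of the series and the membership in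
    \<open>S\<close> are read off from \<open>av\<close>.\<close>
  define h where "h = (\<lambda>w. \<Sum>k. c (n * k) * w ^ k)"
  have root: "\<exists>z. norm z < 1 \<and> z ^ n = w" if "norm w < 1" for w :: complex
  proof -
    have "card {z. z ^ n = w} > 0 \<or> w = 0"
      using card_nth_roots[of w n] \<open>n > 0\<close> by auto
    then obtain z where z: "z ^ n = w"
      using \<open>n > 0\<close> by (cases "w = 0") (force simp: card_gt_0_iff)+
    moreover have "norm z < 1"
    proof (rule ccontr)
      assume "\<not> norm z < 1"
      then have "1 \<le> norm z ^ n" by (simp add: one_le_power)
      then show False using that z by (metis norm_power not_less)
    qed
    ultimately show ?thesis by blast
  qed
  have summ: "summable (\<lambda>k. c (n * k) * w ^ k)" if "norm w < 1" for w
    using root[OF that] av_sums by (auto simp: sums_iff)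
  have h_deriv: "(h has_field_derivative (\<Sum>k. diffs (\<lambda>k. c (n * k)) k * w ^ k)) (at w)"
    if "norm w < 1" for w
    unfolding h_def by (rule termdiffs_strong'[OF summ]) (use that in auto)
  show ?thesis
  proof
    show "h holomorphic_on ball 0 1"
      unfolding holomorphic_on_open[OF open_ball] using h_deriv by (metis mem_ball_0)
    show "h 0 = 0"
      using powser_sums_zero[of "\<lambda>k. c (n * k)"] by (simp add: h_def sums_iff c_def g0)
    show "h w \<in> S" if w: "norm w < 1" for w
    proof -
      obtain z where z: "norm z < 1" "z ^ n = w" using root[OF w] by blast
      have "h w = av z" using av_sums[OF z(1)] z(2) by (simp add: h_def sums_iff)
      also have "\<dots> \<in> S" unfolding av_def
        by (rule convex_sum) (use assms z in \<open>auto simp: norm_mult norm_power norm_\<omega>\<close>)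
      finally show ?thesis .
    qed
    have "(\<Sum>k. diffs (\<lambda>k. c (n * k)) k * 0 ^ k) = c n"
      using powser_sums_zero[of "diffs (\<lambda>k. c (n * k))"] by (simp add: sums_iff diffs_def)
    then show "deriv h 0 = (deriv ^^ n) g 0 / fact n"
      using h_deriv[of 0] by (simp add: DERIV_imp_deriv c_def)
  qed
qed

text \<open>The half-strip is an intersection of three half-planes, so the averaged function stays
  in it, and its linear coefficient obeys both derivative bounds above, \<open>2 * L\<close> and
  4.\<close>

lemma half_strip_coeff_bound:
  fixes g :: "complex \<Rightarrow> complex"
  assumes holg: "g holomorphic_on ball 0 1" and g0: "g 0 = 0" and "n > 0" and "L > 0"
    and Re: "\<And>z. norm z < 1 \<Longrightarrow> Re (g z) \<le> L"
    and Im: "\<And>z. norm z < 1 \<Longrightarrow> \<bar>Im (g z)\<bar> \<le> pi"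
  shows "norm ((deriv ^^ n) g 0 / fact n) \<le> (L + pi) - 1 / (L + pi)"
proof -
  define S where "S = {w. Re w \<le> L} \<inter> {w. Im w \<le> pi} \<inter> {w. Im w \<ge> - pi}"
  have "convex S"
    unfolding S_def by (intro convex_Int convex_halfspace_Re_le convex_halfspace_Im_le convex_halfspace_Im_ge)
  moreover have "g z \<in> S" if "norm z < 1" for z
    using Re[OF that] Im[OF that] by (auto simp: S_def)
  ultimately obtain h where h: "h holomorphic_on ball 0 1" "h 0 = 0"
    "\<And>z. norm z < 1 \<Longrightarrow> h z \<in> S" "deriv h 0 = (deriv ^^ n) g 0 / fact n"
    using rogosinski_average[OF holg g0 \<open>n > 0\<close>, of S] by metis
  have "norm (deriv h 0) \<le> 2 * L"
    by (rule half_plane_deriv_bound) (use h \<open>L > 0\<close> in \<open>auto simp: S_def\<close>)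
  moreover have "norm (deriv h 0) \<le> 4"
    by (rule strip_deriv_bound) (use h in \<open>force simp: S_def\<close>)+
  \<comment> \<open>As 1 / (L + pi) <= 1/3, the first alternative holds for L <= pi - 1/3; beyond
    that, L + pi - 1/3 > 2 pi - 2/3 > 4.\<close>
  moreover have "2 * L \<le> (L + pi) - 1 / (L + pi) \<or> 4 \<le> (L + pi) - 1 / (L + pi)"
  proof -
    have "1 / (L + pi) \<le> 1 / 3" using pi_gt3 \<open>L > 0\<close> by (intro divide_left_mono) auto
    then show ?thesis using pi_gt3 by linarith
  qed
  ultimately show ?thesis using h(4) by auto
qed

section \<open>Pointwise estimates from coefficient bounds and from the Schwarz lemma\<close>

text \<open>As the coefficients of index 0 and 1 are prescribed, both differences are power series
  tails starting at index 2. They are dominated by \<open>c\<close> times tails of the geometric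
  series and of its derivative.\<close>

lemma coeff_bound_imp_near_id:
  fixes A :: "complex \<Rightarrow> complex"
  assumes holA: "A holomorphic_on ball 0 1" and A0: "A 0 = 0" and A1: "deriv A 0 = 1"
    and c: "\<And>n. n \<ge> 2 \<Longrightarrow> norm ((deriv ^^ n) A 0 / fact n) \<le> c" and z: "norm z < 1"
  shows "norm (A z - z) \<le> c * ((norm z)\<^sup>2 / (1 - norm z))"
    and "norm (deriv A z - 1) \<le> c * (1 / (1 - norm z)\<^sup>2 - 1)"
proof -
  define b where "b = (\<lambda>n. (deriv ^^ n) A 0 / fact n)"
  define r where "r = norm z"
  have r: "0 \<le> r" "r < 1" using z by (auto simp: r_def)
  have b: "b 0 = 0" "b 1 = 1" by (simp_all add: b_def A0 A1)
  have "(\<lambda>n. b n * z ^ n) sums A z"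
    using holomorphic_power_series[OF holA, of z] z by (simp add: b_def)
  then have "(\<lambda>n. b (n + 2) * z ^ (n + 2)) sums (A z - (\<Sum>i<2. b i * z ^ i))"
    by (rule sums_split_initial_segment)
  then have s1: "(\<lambda>n. b (n + 2) * z ^ (n + 2)) sums (A z - z)"
    using b by (simp add: numeral_2_eq_2)
  have g1: "(\<lambda>n. c * (r\<^sup>2 * r ^ n)) sums (c * (r\<^sup>2 * (1 / (1 - r))))"
    by (intro sums_mult geometric_sums) (use r in auto)
  have "norm (\<Sum>n. b (n + 2) * z ^ (n + 2)) \<le> (\<Sum>n. c * (r\<^sup>2 * r ^ n))"
  proof (rule norm_suminf_le)
    fix n
    have "norm (b (n + 2)) * r ^ (n + 2) \<le> c * r ^ (n + 2)"
      using c[of "n + 2"] r by (intro mult_right_mono) (auto simp: b_def)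
    then show "norm (b (n + 2) * z ^ (n + 2)) \<le> c * (r\<^sup>2 * r ^ n)"
      by (simp add: norm_mult norm_power r_def power_add power2_eq_square mult_ac)
  qed (use g1 in \<open>auto simp: sums_iff\<close>)
  then show "norm (A z - z) \<le> c * ((norm z)\<^sup>2 / (1 - norm z))"
    using s1 g1 by (simp add: sums_iff r_def)
  have "deriv A holomorphic_on ball 0 1" by (intro holomorphic_deriv holA) auto
  then have "(\<lambda>n. (deriv ^^ n) (deriv A) 0 / fact n * z ^ n) sums deriv A z"
    using holomorphic_power_series[of "deriv A" 0 1 z] z by simp
  moreover have "(deriv ^^ n) (deriv A) 0 / fact n = of_nat (Suc n) * b (Suc n)" for n
    by (simp add: b_def funpow_swap1[symmetric] field_simps del: of_nat_Suc)
  ultimately have "(\<lambda>n. of_nat (Suc n) * b (Suc n) * z ^ n) sums deriv A z" by simp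
  from sums_split_initial_segment[OF this, of 1]
  have s2: "(\<lambda>n. of_nat (n + 2) * b (n + 2) * z ^ (n + 1)) sums (deriv A z - 1)"
    using b by (simp add: numeral_2_eq_2)
  have "(\<lambda>n. of_nat (Suc n) * r ^ n) sums (1 / (1 - r)\<^sup>2)"
    by (rule geometric_deriv_sums) (use r in auto)
  from sums_split_initial_segment[OF this, of 1]
  have "(\<lambda>n. real (n + 2) * r ^ (n + 1)) sums (1 / (1 - r)\<^sup>2 - 1)"
    by (simp add: numeral_2_eq_2)
  then have g2: "(\<lambda>n. c * (real (n + 2) * r ^ (n + 1))) sums (c * (1 / (1 - r)\<^sup>2 - 1))"
    by (rule sums_mult)
  have "norm (\<Sum>n. of_nat (n + 2) * b (n + 2) * z ^ (n + 1))
      \<le> (\<Sum>n. c * (real (n + 2) * r ^ (n + 1)))"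
  proof (rule norm_suminf_le)
    fix n
    have "norm (b (n + 2)) * (real (n + 2) * r ^ (n + 1)) \<le> c * (real (n + 2) * r ^ (n + 1))"
      using c[of "n + 2"] r by (intro mult_right_mono) (auto simp: b_def)
    then show "norm (of_nat (n + 2) * b (n + 2) * z ^ (n + 1)) \<le> c * (real (n + 2) * r ^ (n + 1))"
      unfolding norm_mult norm_power norm_of_nat r_def by (simp add: mult_ac)
  qed (use g2 in \<open>auto simp: sums_iff\<close>)
  then show "norm (deriv A z - 1) \<le> c * (1 / (1 - norm z)\<^sup>2 - 1)"
    using s2 g2 by (simp add: sums_iff r_def)
qed

text \<open>Schwarz-Pick for \<phi> / \<Lambda>, which is 1 / \<Lambda> at 0: it gives \<phi> =
  \<Lambda> (1 + \<Lambda> \<psi>) / (\<Lambda> + \<psi>) with |\<psi>(z)| <= |z|, and the bound is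
  the value of this expression at \<psi> = -|z|.\<close>

lemma bounded_imp_Re_ge:
  fixes \<phi> :: "complex \<Rightarrow> complex"
  assumes hol: "\<phi> holomorphic_on ball 0 1" and \<phi>0: "\<phi> 0 = 1" and "\<Lambda> > 1"
    and bd: "\<And>z. norm z < 1 \<Longrightarrow> norm (\<phi> z) < \<Lambda>" and z: "norm z < 1"
  shows "\<Lambda> * ((1 - \<Lambda> * norm z) / (\<Lambda> - norm z)) \<le> Re (\<phi> z)"
proof -
  have ne: "of_real \<Lambda> ^ 2 - \<phi> w \<noteq> 0" if "norm w < 1" for w
  proof
    assume "of_real \<Lambda> ^ 2 - \<phi> w = 0"
    then have "\<phi> w = of_real (\<Lambda> ^ 2)" by simp
    then have "norm (\<phi> w) = \<Lambda> ^ 2" by (simp only: norm_of_real) simp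
    moreover have "\<Lambda> * 1 \<le> \<Lambda> * \<Lambda>" using \<open>\<Lambda> > 1\<close> by (intro mult_left_mono) auto
    ultimately show False using bd[OF that] by (simp add: power2_eq_square)
  qed
  \<comment> \<open>The disk automorphism moving 1 / \<Lambda> to 0, applied to \<phi> / \<Lambda>
    and cleared of inner fractions.\<close>
  define \<psi> where "\<psi> = (\<lambda>w. of_real \<Lambda> * (\<phi> w - 1) / (of_real \<Lambda> ^ 2 - \<phi> w))"
  have "norm (\<psi> w) < 1" if w: "norm w < 1" for w
  proof -
    have "(norm (\<phi> w))\<^sup>2 < \<Lambda>\<^sup>2" using bd[OF w] by (intro power_strict_mono) auto
    then have "0 < (\<Lambda>\<^sup>2 - 1) * (\<Lambda>\<^sup>2 - (norm (\<phi> w))\<^sup>2)" using \<open>\<Lambda> > 1\<close> by simp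
    also have "\<dots> = (norm (of_real \<Lambda> ^ 2 - \<phi> w))\<^sup>2 - (norm (of_real \<Lambda> * (\<phi> w - 1)))\<^sup>2"
      unfolding cmod_power2 by (simp add: power2_eq_square algebra_simps)
    finally have "norm (of_real \<Lambda> * (\<phi> w - 1)) < norm (of_real \<Lambda> ^ 2 - \<phi> w)"
      by (intro power2_less_imp_less[of "norm (of_real \<Lambda> * (\<phi> w - 1))"]) auto
    then show ?thesis using ne[OF w] by (simp add: \<psi>_def norm_divide)
  qed
  moreover have "\<psi> holomorphic_on ball 0 1"
    unfolding \<psi>_def by (intro holomorphic_intros hol) (use ne in auto)
  moreover have "\<psi> 0 = 0" by (simp add: \<psi>_def \<phi>0)
  ultimately have \<psi>: "norm (\<psi> z) \<le> norm z" using z by (intro Schwarz_Lemma(1)) auto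
  have low: "\<Lambda> - norm z \<le> norm (of_real \<Lambda> + \<psi> z)"
    using norm_diff_ineq[of "of_real \<Lambda>" "\<psi> z"] \<psi> \<open>\<Lambda> > 1\<close> by simp
  have pos: "0 < \<Lambda> - norm z" using z \<open>\<Lambda> > 1\<close> by simp
  then have nz: "of_real \<Lambda> + \<psi> z \<noteq> 0" using low by auto
  have "\<psi> z * (of_real \<Lambda> ^ 2 - \<phi> z) = of_real \<Lambda> * (\<phi> z - 1)" using ne[OF z] by (simp add: \<psi>_def)
  then have "\<phi> z * (of_real \<Lambda> + \<psi> z)
      = of_real \<Lambda> * (of_real \<Lambda> * (of_real \<Lambda> + \<psi> z) - (of_real \<Lambda> ^ 2 - 1))"
    by (simp add: algebra_simps power2_eq_square)
  \<comment> \<open>Here \<psi> occurs only in a reciprocal with a negative coefficient, so an upper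
    bound on the real part of that reciprocal suffices, and its modulus provides one.\<close>
  then have "\<phi> z = of_real \<Lambda> * (of_real \<Lambda> - of_real (\<Lambda>\<^sup>2 - 1) * (1 / (of_real \<Lambda> + \<psi> z)))"
    using nz by (simp add: field_simps)
  then have "Re (\<phi> z) = \<Lambda> * (\<Lambda> - (\<Lambda>\<^sup>2 - 1) * Re (1 / (of_real \<Lambda> + \<psi> z)))"
    by (simp only: minus_complex.sel times_complex.sel Re_complex_of_real Im_complex_of_real) simp
  moreover have "Re (1 / (of_real \<Lambda> + \<psi> z)) \<le> 1 / (\<Lambda> - norm z)"
  proof -
    have "Re (1 / (of_real \<Lambda> + \<psi> z)) \<le> norm (1 / (of_real \<Lambda> + \<psi> z))" by (rule complex_Re_le_cmod)
    also have "\<dots> \<le> 1 / (\<Lambda> - norm z)"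
      unfolding norm_divide norm_one using low pos by (intro divide_left_mono mult_pos_pos) auto
    finally show ?thesis .
  qed
  then have "\<Lambda> * (\<Lambda> - (\<Lambda>\<^sup>2 - 1) * (1 / (\<Lambda> - norm z)))
      \<le> \<Lambda> * (\<Lambda> - (\<Lambda>\<^sup>2 - 1) * Re (1 / (of_real \<Lambda> + \<psi> z)))"
    using \<open>\<Lambda> > 1\<close> by (intro mult_left_mono diff_left_mono) auto
  moreover have "\<Lambda> - (\<Lambda>\<^sup>2 - 1) * (1 / (\<Lambda> - norm z)) = (1 - \<Lambda> * norm z) / (\<Lambda> - norm z)"
    using pos by (simp add: field_simps power2_eq_square)
  ultimately show ?thesis by simp
qed

section \<open>Injectivity, growth and covering for real differentiable maps\<close>

text \<open>Multiplying by \<open>cnj h\<close> and taking real parts is the inner product with the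
  direction \<open>h\<close>; this reduces the next two results to monotonicity of real functions on
  segments.\<close>

lemma has_real_derivative_Re_along_line:
  fixes F :: "complex \<Rightarrow> complex"
  assumes "(F has_derivative D) (at (x + of_real t * h))"
  shows "((\<lambda>t. Re (cnj h * F (x + of_real t * h))) has_real_derivative Re (cnj h * D h)) (at t)"
proof -
  interpret D: bounded_linear D using assms by (rule has_derivative_bounded_linear)
  have "((\<lambda>t. x + of_real t * h) has_derivative (\<lambda>s. of_real s * h)) (at t)"
    by (auto intro!: derivative_eq_intros)
  from has_derivative_compose[OF this assms]
  have "((\<lambda>t. F (x + of_real t * h)) has_derivative (\<lambda>s. D (of_real s * h))) (at t)" .
  then have "((\<lambda>t. Re (cnj h * F (x + of_real t * h))) has_derivative
      (\<lambda>s. Re (cnj h * D (of_real s * h)))) (at t)"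
    by (auto intro!: derivative_eq_intros)
  moreover have "(\<lambda>s. Re (cnj h * D (of_real s * h))) = (\<lambda>s. Re (cnj h * D h) * s)"
    by (simp add: fun_eq_iff D.scaleR flip: scaleR_conv_of_real)
  ultimately show ?thesis by (simp add: has_field_derivative_def)
qed

text \<open>The Noshiro-Warschawski argument with a real linear derivative: along the segment from x
  to y, the component of \<open>F\<close> in direction y - x strictly increases, so the end values
  differ.\<close>

lemma Re_derivative_pos_imp_inj_on:
  fixes F :: "complex \<Rightarrow> complex"
  assumes "convex S" and der: "\<And>z. z \<in> S \<Longrightarrow> (F has_derivative F' z) (at z)"
    and pos: "\<And>z h. z \<in> S \<Longrightarrow> h \<noteq> 0 \<Longrightarrow> 0 < Re (cnj h * F' z h)"
  shows "inj_on F S"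
proof (rule inj_onI, rule ccontr)
  fix x y assume xy: "x \<in> S" "y \<in> S" "F x = F y" "x \<noteq> y"
  define h where "h = y - x"
  define g where "g = (\<lambda>t. Re (cnj h * F (x + of_real t * h)))"
  have "g 0 < g 1"
  proof (rule DERIV_pos_imp_increasing[where f = g])
    fix t :: real assume t: "0 \<le> t" "t \<le> 1"
    have "(1 - t) *\<^sub>R x + t *\<^sub>R y \<in> S" using t xy by (intro convexD_alt assms(1)) auto
    then have in_S: "x + of_real t * h \<in> S" by (simp add: h_def scaleR_conv_of_real algebra_simps)
    show "\<exists>d. DERIV g t :> d \<and> 0 < d"
      unfolding g_def
      using has_real_derivative_Re_along_line[OF der[OF in_S]] pos[OF in_S, of h] xy(4)
      by (auto simp: h_def)
  qed simp
  then show False using xy(3) by (simp add: g_def h_def)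
qed

text \<open>Along the radius to \<open>z\<close>, the excess of the radial component of
  \<open>F\<close> over the primitive \<open>S\<close> of \<open>E\<close> starts at 0 and does not
  decrease; the radial component is at most the modulus.\<close>

lemma Re_derivative_ge_imp_growth:
  fixes F :: "complex \<Rightarrow> complex"
  assumes der: "\<And>z. norm z < R \<Longrightarrow> (F has_derivative F' z) (at z)"
    and ge: "\<And>z h. norm z < R \<Longrightarrow> E (norm z) * (norm h)\<^sup>2 \<le> Re (cnj h * F' z h)"
    and S: "\<And>r. 0 \<le> r \<Longrightarrow> r < R \<Longrightarrow> (S has_real_derivative E r) (at r)"
    and "F 0 = 0" "S 0 = 0" and z: "norm z < R"
  shows "S (norm z) \<le> norm (F z)"
proof (cases "z = 0")
  case False
  \<comment> \<open>The summand 0 keeps the shape \<open>x + of_real t * h\<close> that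
    \<open>has_real_derivative_Re_along_line\<close> expects.\<close>
  define g where "g = (\<lambda>t. Re (cnj z * F (0 + of_real t * z)) - norm z * S (t * norm z))"
  have "g 0 \<le> g 1"
  proof (rule DERIV_nonneg_imp_nondecreasing[where f = g])
    fix t :: real assume t: "0 \<le> t" "t \<le> 1"
    have "t * norm z \<le> 1 * norm z" using t by (intro mult_right_mono) auto
    then have n: "norm (0 + of_real t * z) < R" "t * norm z < R" using z t by (auto simp: norm_mult)
    have "((\<lambda>t. norm z * S (t * norm z)) has_real_derivative
        norm z * (E (t * norm z) * norm z)) (at t)"
      by (intro DERIV_cmult DERIV_chain2[where g = "\<lambda>t. t * norm z" and f = S] S)
        (use t n in \<open>auto intro!: derivative_eq_intros\<close>)
    then have "(g has_real_derivative Re (cnj z * F' (0 + of_real t * z) z)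
        - norm z * (E (t * norm z) * norm z)) (at t)"
      unfolding g_def by (intro DERIV_diff has_real_derivative_Re_along_line der n)
    moreover have "norm z * (E (t * norm z) * norm z) \<le> Re (cnj z * F' (0 + of_real t * z) z)"
      using ge[OF n(1), of z] t by (simp add: norm_mult power2_eq_square mult_ac)
    ultimately show "\<exists>y. DERIV g t :> y \<and> 0 \<le> y" by fastforce
  qed simp
  then have "norm z * S (norm z) \<le> Re (cnj z * F z)" using assms(4,5) by (simp add: g_def)
  also have "\<dots> \<le> norm z * norm (F z)"
    using complex_Re_le_cmod[of "cnj z * F z"] by (simp only: norm_mult complex_mod_cnj)
  finally show ?thesis using False by simp
qed (use assms in simp)

text \<open>The covered part of \<open>ball 0 s\<close> is open by invariance of domain. It is also
  relatively closed, because the closed disk has compact image and its boundary lands outside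
  \<open>ball 0 s\<close>. It contains 0, so by connectedness it is everything.\<close>

lemma ball_subset_image_if_inj_on:
  fixes F :: "complex \<Rightarrow> complex"
  assumes cont: "continuous_on (cball 0 \<rho>) F" and inj: "inj_on F (ball 0 \<rho>)"
    and "F 0 = 0" "0 < \<rho>" "0 < s" and bd: "\<And>z. norm z = \<rho> \<Longrightarrow> s \<le> norm (F z)"
  shows "ball 0 s \<subseteq> F ` ball 0 \<rho>"
proof -
  have "open (F ` ball 0 \<rho>)"
    by (intro invariance_of_domain inj continuous_on_subset[OF cont]) auto
  moreover have "closed (F ` cball 0 \<rho>)"
    by (intro compact_imp_closed compact_continuous_image cont) auto
  moreover have eq: "ball 0 s \<inter> F ` cball 0 \<rho> = ball 0 s \<inter> F ` ball 0 \<rho>"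
    using bd by (force simp: le_less)
  ultimately have "openin (top_of_set (ball 0 s)) (ball 0 s \<inter> F ` ball 0 \<rho>)"
    "closedin (top_of_set (ball 0 s)) (ball 0 s \<inter> F ` ball 0 \<rho>)"
    by (auto intro: openin_open_Int) (metis closedin_closed_Int)
  moreover have "0 \<in> ball 0 s \<inter> F ` ball 0 \<rho>" using assms by force
  moreover have "connected (ball (0::complex) s)" by (intro convex_connected convex_ball)
  ultimately have "ball 0 s \<inter> F ` ball 0 \<rho> = ball 0 s"
    unfolding connected_clopen by blast
  then show ?thesis by blast
qed

text \<open>The region is the preimage of the disk; it is connected because invariance of domain
  makes the inverse of \<open>f\<close> continuous.\<close>

lemma schlicht_disk_if_subset_image:
  assumes "open S" and cont: "continuous_on S f" and inj: "inj_on f S"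
    and sub: "ball w r \<subseteq> f ` S" and "0 < r"
  shows "schlicht_disk f S w r"
proof -
  obtain g where g: "homeomorphism S (f ` S) f g"
    by (rule invariance_of_domain_homeomorphism[OF \<open>open S\<close> cont _ inj]) auto
  let ?G = "S \<inter> f -` ball w r"
  have "open ?G" by (intro continuous_open_preimage cont assms) auto
  moreover have img: "f ` ?G = ball w r" using sub by blast
  moreover have "?G = g ` ball w r"
    using sub homeomorphism_apply1[OF g] homeomorphism_apply2[OF g] homeomorphism_image2[OF g]
    by (force simp: image_iff)
  then have "connected ?G"
    using connected_continuous_image[OF continuous_on_subset[OF homeomorphism_cont2[OF g] sub]]
    by simp
  moreover have "?G \<noteq> {}" using img \<open>0 < r\<close> by (metis ball_eq_empty image_empty not_le)
  ultimately show ?thesis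
    unfolding schlicht_disk_def using inj_on_subset[OF inj] by (intro exI[of _ ?G]) auto
qed

section \<open>The exponential image of a disk about the origin\<close>

text \<open>The function cosh R exp(-R^2/2) has logarithmic derivative tanh R - R, which is at most
  0 for R >= 0, so it decreases from \<open>x\<close> to \<open>R\<close>.\<close>

lemma cosh_le_cosh_mult_exp:
  fixes x R :: real
  assumes "0 \<le> x" "x \<le> R"
  shows "cosh R * exp (x\<^sup>2 / 2) \<le> cosh x * exp (R\<^sup>2 / 2)"
proof -
  have "cosh R * exp (- (R\<^sup>2 / 2)) \<le> cosh x * exp (- (x\<^sup>2 / 2))"
  proof (rule DERIV_nonpos_imp_nonincreasing[OF assms(2), where f = "\<lambda>R. cosh R * exp (- (R\<^sup>2 / 2))"])
    fix t assume t: "x \<le> t" "t \<le> R"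
    have "sinh t \<le> t * cosh t"
    proof -
      have "(\<lambda>t. t * cosh t - sinh t) 0 \<le> (\<lambda>t::real. t * cosh t - sinh t) t"
      proof (rule DERIV_nonneg_imp_nondecreasing[where f = "\<lambda>t. t * cosh t - sinh t"])
        fix u :: real assume "0 \<le> u"
        moreover have "((\<lambda>t. t * cosh t - sinh t) has_real_derivative u * sinh u) (at u)"
          by (auto intro!: derivative_eq_intros)
        ultimately show "\<exists>y. ((\<lambda>t. t * cosh t - sinh t) has_real_derivative y) (at u) \<and> 0 \<le> y"
          by (auto intro!: exI[of _ "u * sinh u"])
      qed (use t assms in auto)
      then show ?thesis by simp
    qed
    then have "(sinh t - t * cosh t) * exp (- (t\<^sup>2 / 2)) \<le> 0"
      by (simp add: mult_le_0_iff)
    moreover have "((\<lambda>R. cosh R * exp (- (R\<^sup>2 / 2))) has_real_derivative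
        (sinh t - t * cosh t) * exp (- (t\<^sup>2 / 2))) (at t)"
      by (auto intro!: derivative_eq_intros simp: algebra_simps)
    ultimately show "\<exists>y. ((\<lambda>R. cosh R * exp (- (R\<^sup>2 / 2))) has_real_derivative y) (at t) \<and> y \<le> 0"
      by blast
  qed
  then show ?thesis by (simp add: exp_minus field_simps)
qed

text \<open>The derivative of the left-hand side has the sign of y cos y - sin y, which is 0 at 0
  and has derivative -y sin y <= 0.\<close>

lemma cos_mult_exp_le_1:
  fixes y :: real
  assumes "0 \<le> y" "y \<le> pi / 2"
  shows "cos y * exp (y\<^sup>2 / 2) \<le> 1"
proof -
  have "cos y * exp (y\<^sup>2 / 2) \<le> cos 0 * exp (0\<^sup>2 / 2)"
  proof (rule DERIV_nonpos_imp_nonincreasing[OF assms(1), where f = "\<lambda>y. cos y * exp (y\<^sup>2 / 2)"])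
    fix t assume t: "0 \<le> t" "t \<le> y"
    have "t * cos t \<le> sin t"
    proof -
      have "(\<lambda>t. sin t - t * cos t) 0 \<le> (\<lambda>t::real. sin t - t * cos t) t"
      proof (rule DERIV_nonneg_imp_nondecreasing[where f = "\<lambda>t. sin t - t * cos t"])
        fix u :: real assume "0 \<le> u" "u \<le> t"
        moreover have "((\<lambda>t. sin t - t * cos t) has_real_derivative u * sin u) (at u)"
          by (auto intro!: derivative_eq_intros)
        moreover have "0 \<le> sin u" using t assms \<open>0 \<le> u\<close> \<open>u \<le> t\<close> pi_gt_zero by (intro sin_ge_zero) linarith+
        ultimately show "\<exists>y. ((\<lambda>t. sin t - t * cos t) has_real_derivative y) (at u) \<and> 0 \<le> y"
          by (auto intro!: exI[of _ "u * sin u"])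
      qed (use t assms in auto)
      then show ?thesis by simp
    qed
    then have "(t * cos t - sin t) * exp (t\<^sup>2 / 2) \<le> 0"
      by (simp add: mult_le_0_iff)
    moreover have "((\<lambda>y. cos y * exp (y\<^sup>2 / 2)) has_real_derivative
        (t * cos t - sin t) * exp (t\<^sup>2 / 2)) (at t)"
      by (auto intro!: derivative_eq_intros simp: algebra_simps)
    ultimately show "\<exists>d. ((\<lambda>y. cos y * exp (y\<^sup>2 / 2)) has_real_derivative d) (at t) \<and> d \<le> 0"
      by blast
  qed
  then show ?thesis by simp
qed

text \<open>In the coordinates $w = e^{x+iy}$ the disk is $\cosh x < \cos y\,\cosh\sigma$, and
  $\cosh\sqrt{x^2+y^2} \le e^{y^2/2}\cosh x$ together with $\cos y \le e^{-y^2/2}$ forces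
  $x^2+y^2 < \sigma^2$.\<close>

lemma norm_Ln_less_if_mem_ball_cosh:
  fixes w :: complex
  assumes "0 < s" and w: "w \<in> ball (of_real (cosh s)) (sinh s)"
  shows "w \<noteq> 0" "norm (Ln w) < s"
proof -
  have "(norm (w - of_real (cosh s)))\<^sup>2 < (sinh s)\<^sup>2"
    using w \<open>0 < s\<close> by (intro power_strict_mono) (auto simp: dist_norm norm_minus_commute)
  \<comment> \<open>The 1 is cosh^2 s - sinh^2 s; dividing by |w| = e^x below turns |w| + 1/|w| into
    2 cosh x.\<close>
  then have w2: "(norm w)\<^sup>2 + 1 < 2 * Re w * cosh s"
    unfolding cmod_power2 sinh_square_eq by (simp add: power2_eq_square algebra_simps)
  then show "w \<noteq> 0" by auto
  define x y where "x = Re (Ln w)" and "y = Im (Ln w)"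
  have "w = exp (Complex x y)" using \<open>w \<noteq> 0\<close> by (metis x_def y_def complex.collapse exp_Ln)
  then have nw: "norm w = exp x" and Rew: "Re w = exp x * cos y" by (simp_all add: Re_exp)
  have "exp x * (2 * cosh x) = (norm w)\<^sup>2 + 1"
    by (simp add: nw cosh_def power2_eq_square algebra_simps flip: exp_add)
  also have "\<dots> < exp x * (2 * (cos y * cosh s))" using w2 Rew by (simp add: mult_ac)
  finally have main: "cosh x < cos y * cosh s" by simp
  then have "0 < cos y" using cosh_real_pos[of x] cosh_real_pos[of s]
    by (metis less_trans zero_less_mult_pos2)
  then have "Re w > 0" by (simp add: Rew)
  \<comment> \<open>A positive real part confines the argument to the range where
    \<open>cos_mult_exp_le_1\<close> is available.\<close>
  then have y: "\<bar>y\<bar> < pi / 2" unfolding y_def using Re_Ln_pos_lt[OF \<open>w \<noteq> 0\<close>] by simp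
  show "norm (Ln w) < s"
  proof (rule ccontr)
    define R where "R = norm (Ln w)"
    assume "\<not> norm (Ln w) < s"
    then have R: "s \<le> R" "\<bar>x\<bar> \<le> R" unfolding R_def x_def using abs_Re_le_cmod by auto
    have R2: "R\<^sup>2 = x\<^sup>2 + y\<^sup>2" by (simp add: R_def cmod_power2 x_def y_def)
    have "cosh R * exp (x\<^sup>2 / 2) \<le> cosh x * exp (R\<^sup>2 / 2)"
      using cosh_le_cosh_mult_exp[of "\<bar>x\<bar>" R] R by simp
    then have "cosh R \<le> cosh x * exp (y\<^sup>2 / 2)"
      by (simp add: R2 add_divide_distrib exp_add mult_ac)
    then have "cos y * cosh R \<le> cosh x * (cos y * exp (y\<^sup>2 / 2))"
      using mult_left_mono[of _ _ "cos y"] \<open>0 < cos y\<close> by (metis less_imp_le mult.left_commute)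
    also have "\<dots> \<le> cosh x * 1"
      using cos_mult_exp_le_1[of "\<bar>y\<bar>"] y by (intro mult_left_mono) auto
    finally have "cos y * cosh R \<le> cosh x" by simp
    moreover have "cos y * cosh s \<le> cos y * cosh R"
      using R \<open>0 < s\<close> \<open>0 < cos y\<close> by (intro mult_left_mono) (auto simp: cosh_real_nonneg_le_iff)
    ultimately show False using main by linarith
  qed
qed

section \<open>The equation for the radius and the primitive of its left-hand side\<close>

text \<open>The Moebius term decreases strictly, its derivative having the sign of 1 - \<Lambda>^2,
  while the subtracted sums do not decrease, since the weights \<open>M k - 1 / M k\<close> are
  nonnegative.\<close>

lemma rho_eqn_strict_antimono:
  assumes "\<Lambda> > 1" and M: "\<And>k. k \<in> {1..p-1} \<Longrightarrow> 1 \<le> M k" and rs: "0 \<le> r" "r < s" "s < 1"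
  shows "rho_eqn p \<Lambda> M s < rho_eqn p \<Lambda> M r"
proof -
  have "(1 - \<Lambda> * s) / (\<Lambda> - s) < (1 - \<Lambda> * r) / (\<Lambda> - r)"
  proof -
    have "1 < \<Lambda> * \<Lambda>" using \<open>\<Lambda> > 1\<close> less_1_mult by blast
    then have "0 < (\<Lambda> * \<Lambda> - 1) * (s - r)" using rs by simp
    then show ?thesis using rs \<open>\<Lambda> > 1\<close> by (simp add: divide_simps algebra_simps)
  qed
  then have "\<Lambda> * ((1 - \<Lambda> * s) / (\<Lambda> - s)) < \<Lambda> * ((1 - \<Lambda> * r) / (\<Lambda> - r))"
    using \<open>\<Lambda> > 1\<close> by (intro mult_strict_left_mono) auto
  moreover have "(\<Sum>k=1..p-1. (M k - 1 / M k) * (r ^ (k+1) * (2 - r + real k * (1 - r)) / (1 - r)\<^sup>2))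
      \<le> (\<Sum>k=1..p-1. (M k - 1 / M k) * (s ^ (k+1) * (2 - s + real k * (1 - s)) / (1 - s)\<^sup>2))"
  proof (intro sum_mono mult_left_mono)
    fix k assume k: "k \<in> {1..p-1}"
    \<comment> \<open>The factor 2 - t + k (1 - t) decreases in t; in the rewritten form only
      nondecreasing factors remain.\<close>
    have split: "t ^ (k+1) * (2 - t + real k * (1 - t)) / (1 - t)\<^sup>2
        = t ^ (k+1) * ((1 + real k) * (1 / (1 - t)) + (1 / (1 - t))\<^sup>2)" if "t < 1" for t :: real
    proof -
      have eq: "2 - t + real k * (1 - t) = (1 + real k) * (1 - t) + 1" by (simp add: algebra_simps)
      show ?thesis unfolding eq using that by (simp add: add_divide_distrib distrib_left power2_eq_square)
    qed
    have "1 / (1 - r) \<le> 1 / (1 - s)" using rs by (intro divide_left_mono) auto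
    then have "r ^ (k+1) * ((1 + real k) * (1 / (1 - r)) + (1 / (1 - r))\<^sup>2)
        \<le> s ^ (k+1) * ((1 + real k) * (1 / (1 - s)) + (1 / (1 - s))\<^sup>2)"
      using rs by (intro mult_mono add_mono mult_left_mono power_mono) auto
    then show "r ^ (k+1) * (2 - r + real k * (1 - r)) / (1 - r)\<^sup>2
        \<le> s ^ (k+1) * (2 - s + real k * (1 - s)) / (1 - s)\<^sup>2"
      using split[of r] split[of s] rs by linarith
    have "1 / M k \<le> 1" using M[OF k] by simp
    then show "0 \<le> M k - 1 / M k" using M[OF k] by linarith
  qed
  moreover have "(\<Sum>k=1..p-1. (real k + 1) * r ^ k) \<le> (\<Sum>k=1..p-1. (real k + 1) * s ^ k)"
    using rs by (intro sum_mono mult_left_mono power_mono) auto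
  ultimately show ?thesis unfolding rho_eqn_def by linarith
qed

lemma continuous_on_rho_eqn:
  assumes "\<Lambda> > 1"
  shows "continuous_on {0..<1} (rho_eqn p \<Lambda> M)"
  unfolding rho_eqn_def by (intro continuous_intros) (use assms in auto)

lemma rho_eqn_0: "\<Lambda> \<noteq> 0 \<Longrightarrow> rho_eqn p \<Lambda> M 0 = 1"
  by (simp add: rho_eqn_def sum.neutral)

lemma sigma_val_0: "sigma_val p \<Lambda> M 0 = 0"
  by (simp add: sigma_val_def)

text \<open>The value at 0 is 1. At \<open>1 / \<Lambda>\<close> the Moebius term vanishes and only
  the subtracted sums remain, so a root lies in between, away from the pole at 1; strict
  monotonicity makes it unique.\<close>

lemma ex1_rho_eqn_root:
  assumes "\<Lambda> > 1" and M: "\<And>k. k \<in> {1..p-1} \<Longrightarrow> 1 \<le> M k"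
  shows "\<exists>!\<rho>. 0 < \<rho> \<and> \<rho> < 1 \<and> rho_eqn p \<Lambda> M \<rho> = 0"
proof -
  have l: "0 \<le> 1 / \<Lambda>" "1 / \<Lambda> < 1" using \<open>\<Lambda> > 1\<close> by auto
  have "rho_eqn p \<Lambda> M (1 / \<Lambda>) \<le> 0"
  proof -
    have "0 \<le> (\<Sum>k=1..p-1. (M k - 1 / M k) * ((1 / \<Lambda>) ^ (k+1) * (2 - 1 / \<Lambda> + real k * (1 - 1 / \<Lambda>)) / (1 - 1 / \<Lambda>)\<^sup>2))"
    proof (intro sum_nonneg mult_nonneg_nonneg divide_nonneg_nonneg)
      fix k assume k: "k \<in> {1..p-1}"
      have "1 / M k \<le> 1" using M[OF k] by simp
      then show "0 \<le> M k - 1 / M k" using M[OF k] by linarith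
      have "0 \<le> real k * (1 - 1 / \<Lambda>)" using l by (intro mult_nonneg_nonneg) auto
      then show "0 \<le> 2 - 1 / \<Lambda> + real k * (1 - 1 / \<Lambda>)" using l by linarith
    qed (use l in auto)
    moreover have "0 \<le> (\<Sum>k=1..p-1. (real k + 1) * (1 / \<Lambda>) ^ k)"
      using l by (intro sum_nonneg mult_nonneg_nonneg) auto
    moreover have "\<Lambda> * ((1 - \<Lambda> * (1 / \<Lambda>)) / (\<Lambda> - 1 / \<Lambda>)) = 0" using \<open>\<Lambda> > 1\<close> by simp
    ultimately show ?thesis unfolding rho_eqn_def by linarith
  qed
  moreover have "continuous_on {0..1 / \<Lambda>} (rho_eqn p \<Lambda> M)"
    by (rule continuous_on_subset[OF continuous_on_rho_eqn[OF \<open>\<Lambda> > 1\<close>]]) (use l in auto)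
  ultimately obtain \<rho> where \<rho>: "0 \<le> \<rho>" "\<rho> \<le> 1 / \<Lambda>" "rho_eqn p \<Lambda> M \<rho> = 0"
    using IVT2'[of "rho_eqn p \<Lambda> M" "1 / \<Lambda>" 0 0] l rho_eqn_0[of \<Lambda> p M] \<open>\<Lambda> > 1\<close> by auto
  then have "\<rho> < 1" using l by linarith
  show ?thesis
  proof (rule ex1I[of _ \<rho>])
    show "0 < \<rho> \<and> \<rho> < 1 \<and> rho_eqn p \<Lambda> M \<rho> = 0"
      using \<rho> \<open>\<rho> < 1\<close> rho_eqn_0[of \<Lambda> p M] \<open>\<Lambda> > 1\<close> by (cases "\<rho> = 0") auto
    fix r assume "0 < r \<and> r < 1 \<and> rho_eqn p \<Lambda> M r = 0"
    then show "r = \<rho>"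
      using rho_eqn_strict_antimono[of \<Lambda> p M r \<rho>] rho_eqn_strict_antimono[of \<Lambda> p M \<rho> r] assms \<rho> \<open>\<rho> < 1\<close>
      by (cases r \<rho> rule: linorder_cases) auto
  qed
qed

text \<open>Together with \<open>sigma_val_0\<close> this makes \<open>sigma_val\<close> the
  integral of \<open>rho_eqn\<close> from 0, the form in which the growth estimate uses it.\<close>

lemma sigma_val_has_derivative_rho_eqn:
  assumes "\<Lambda> > 1" and r: "0 \<le> r" "r < 1"
  shows "(sigma_val p \<Lambda> M has_real_derivative rho_eqn p \<Lambda> M r) (at r)"
proof -
  \<comment> \<open>\<open>S\<close> is \<open>sigma_val\<close> with the closed geometric sum
    expanded into powers, which differentiate to the terms of the last sum in
    \<open>rho_eqn\<close>.\<close>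
  define S where "S = (\<lambda>t. \<Lambda>\<^sup>2 * t + (\<Lambda> ^ 3 - \<Lambda>) * ln (1 - t / \<Lambda>)
     - (\<Sum>k=1..p-1. (M k - 1 / M k) * (t ^ (k+2) / (1 - t))) - (\<Sum>k=1..p-1. t ^ (k+1)))"
  have geom: "(\<Sum>k=1..m. t ^ (k+1)) = t\<^sup>2 * ((1 - t ^ m) / (1 - t))" if "t \<noteq> 1" for t :: real and m
  proof -
    have "(1 - t) * (\<Sum>k=1..m. t ^ (k+1)) = t\<^sup>2 * (1 - t ^ m)"
    proof (induction m)
      case (Suc m)
      have step: "(1 - t) * (\<Sum>k=1..Suc m. t ^ (k+1)) = (1 - t) * (\<Sum>k=1..m. t ^ (k+1)) + (1 - t) * t ^ (m+2)"
        by (simp add: distrib_left)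
      show ?case unfolding step Suc.IH by (simp add: algebra_simps power2_eq_square)
    qed simp
    then show ?thesis using that by (simp add: field_simps)
  qed
  have "((\<lambda>t. 1 - t / \<Lambda>) has_real_derivative - (1 / \<Lambda>)) (at r)"
    using \<open>\<Lambda> > 1\<close> by (auto intro!: derivative_eq_intros)
  moreover have "0 < 1 - r / \<Lambda>" using assms by simp
  ultimately have "((\<lambda>t. \<Lambda>\<^sup>2 * t + (\<Lambda> ^ 3 - \<Lambda>) * ln (1 - t / \<Lambda>)) has_real_derivative
      \<Lambda>\<^sup>2 * 1 + (\<Lambda> ^ 3 - \<Lambda>) * (1 / (1 - r / \<Lambda>) * - (1 / \<Lambda>))) (at r)"
    by (intro DERIV_add DERIV_cmult DERIV_ident DERIV_chain2[OF DERIV_ln_divide])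
  moreover have "\<Lambda>\<^sup>2 * 1 + (\<Lambda> ^ 3 - \<Lambda>) * (1 / (1 - r / \<Lambda>) * - (1 / \<Lambda>))
      = \<Lambda> * ((1 - \<Lambda> * r) / (\<Lambda> - r))"
    using assms by (simp add: field_simps power2_eq_square power3_eq_cube)
  ultimately have "((\<lambda>t. \<Lambda>\<^sup>2 * t + (\<Lambda> ^ 3 - \<Lambda>) * ln (1 - t / \<Lambda>)) has_real_derivative
      \<Lambda> * ((1 - \<Lambda> * r) / (\<Lambda> - r))) (at r)"
    by simp
  moreover have "((\<lambda>t. t ^ (k+2) / (1 - t)) has_real_derivative
      r ^ (k+1) * (2 - r + real k * (1 - r)) / (1 - r)\<^sup>2) (at r)" for k
    by (rule derivative_eq_intros refl)+ (use r in \<open>auto simp: field_simps power2_eq_square\<close>)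
  moreover have "((\<lambda>t. t ^ (k+1)) has_real_derivative (real k + 1) * r ^ k) (at r)" for k
    by (rule derivative_eq_intros refl)+ auto
  ultimately have "(S has_real_derivative rho_eqn p \<Lambda> M r) (at r)"
    unfolding S_def rho_eqn_def by (intro DERIV_diff DERIV_sum DERIV_cmult)
  then show ?thesis
  proof (rule has_field_derivative_transform_within_open)
    \<comment> \<open>The neighbourhood \<open>{..<1}\<close> contains negative t, so the derivative
      at r = 0 is two-sided as well.\<close>
    show "S t = sigma_val p \<Lambda> M t" if "t \<in> {..<1}" for t
      using that geom[of t] by (simp add: S_def sigma_val_def del: power_Suc)
  qed (use r in auto)
qed

section \<open>The derivative estimate for polyanalytic sums\<close>

text \<open>The term k = 0 contributes exactly |h|^2 Re A_0'(z), bounded below by Schwarz-Pick. The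
  terms k >= 1 enter only through their norms, which the closeness of A_k to the identity
  controls.\<close>

lemma Re_derivative_polyanalytic_ge:
  fixes A :: "nat \<Rightarrow> complex \<Rightarrow> complex"
  assumes "\<Lambda> > 1"
    and hol: "\<And>k. k \<in> {0..p-1} \<Longrightarrow> A k holomorphic_on ball 0 1"
    and A0: "\<And>k. k \<in> {0..p-1} \<Longrightarrow> A k 0 = 0"
    and A1: "\<And>k. k \<in> {0..p-1} \<Longrightarrow> deriv (A k) 0 = 1"
    and coeff: "\<And>k n. k \<in> {1..p-1} \<Longrightarrow> n > 0 \<Longrightarrow> norm ((deriv ^^ n) (A k) 0 / fact n) \<le> M k - 1 / M k"
    and bd: "\<And>z. norm z < 1 \<Longrightarrow> norm (deriv (A 0) z) < \<Lambda>"
    and z: "norm z < 1"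
  defines "D \<equiv> \<lambda>h. \<Sum>k=0..p-1. cnj z ^ k * (deriv (A k) z * h) + of_nat k * cnj h * cnj z ^ (k-1) * A k z"
  shows "((\<lambda>z. \<Sum>k=0..p-1. cnj z ^ k * A k z) has_derivative D) (at z)"
    and "rho_eqn p \<Lambda> M (norm z) * (norm h)\<^sup>2 \<le> Re (cnj h * D h)"
proof -
  have dA: "(A k has_derivative (\<lambda>h. deriv (A k) z * h)) (at z)" if "k \<in> {0..p-1}" for k
    using holomorphic_derivI[OF hol[OF that], of z] z by (simp add: has_field_derivative_def)
  show "((\<lambda>z. \<Sum>k=0..p-1. cnj z ^ k * A k z) has_derivative D) (at z)"
    unfolding D_def
    by (intro has_derivative_sum has_derivative_mult has_derivative_power dA
        bounded_linear.has_derivative[OF bounded_linear_cnj] has_derivative_ident)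
next
  define r where "r = norm z"
  have r: "0 \<le> r" "r < 1" using z by (auto simp: r_def)
  define T where "T = (\<lambda>k. cnj z ^ k * (deriv (A k) z * h) + of_nat k * cnj h * cnj z ^ (k-1) * A k z)"
  \<comment> \<open>\<open>e k\<close> merges the k-th terms of the two sums in
    \<open>rho_eqn\<close>: the first accounts for the deviation of A_k from the identity, the
    second is the norm bound when A_k is the identity.\<close>
  define e where "e = (\<lambda>k. (M k - 1 / M k) * (r ^ (k+1) * (2 - r + real k * (1 - r)) / (1 - r)\<^sup>2)
    + (real k + 1) * r ^ k)"
  have T: "norm (T k) \<le> e k * norm h" if k: "k \<in> {1..p-1}" for k
  proof -
    define c where "c = M k - 1 / M k"
    have k': "k \<in> {0..p-1}" using k by auto
    have near: "norm (A k z - z) \<le> c * (r\<^sup>2 / (1 - r))" "norm (deriv (A k) z - 1) \<le> c * (1 / (1 - r)\<^sup>2 - 1)"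
      unfolding r_def c_def
      by (rule coeff_bound_imp_near_id[OF hol[OF k'] A0[OF k'] A1[OF k'] _ z], use coeff[OF k] in simp)+
    have a: "norm (A k z) \<le> r + c * (r\<^sup>2 / (1 - r))"
      using near(1) norm_triangle_sub[of "A k z" z] by (simp add: r_def)
    have d: "norm (deriv (A k) z) \<le> 1 + c * (1 / (1 - r)\<^sup>2 - 1)"
      using near(2) norm_triangle_sub[of "deriv (A k) z" 1] by simp
    obtain j where j: "k = Suc j" using k by (cases k) auto
    have "norm (T k) \<le> r ^ k * (norm (deriv (A k) z) * norm h) + real k * norm h * r ^ (k-1) * norm (A k z)"
      unfolding T_def r_def by (rule norm_triangle_le) (simp add: norm_mult norm_power)
    also have "\<dots> = (r ^ k * norm (deriv (A k) z) + real k * r ^ (k-1) * norm (A k z)) * norm h"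
      by (simp add: algebra_simps)
    also have "\<dots> \<le> (r ^ k * (1 + c * (1 / (1 - r)\<^sup>2 - 1)) + real k * r ^ (k-1) * (r + c * (r\<^sup>2 / (1 - r)))) * norm h"
      using a d r by (intro mult_right_mono add_mono mult_left_mono) auto
    also have "r ^ k * (1 + c * (1 / (1 - r)\<^sup>2 - 1)) + real k * r ^ (k-1) * (r + c * (r\<^sup>2 / (1 - r)))
        = c * (r ^ k * (1 / (1 - r)\<^sup>2 - 1) + real k * r ^ (k-1) * (r\<^sup>2 / (1 - r))) + (real k + 1) * r ^ k"
      by (simp add: j algebra_simps add_divide_distrib)
    also have "r ^ k * (1 / (1 - r)\<^sup>2 - 1) + real k * r ^ (k-1) * (r\<^sup>2 / (1 - r))
        = r ^ (k+1) * (2 - r + real k * (1 - r)) / (1 - r)\<^sup>2"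
    proof -
      have "1 - (1 - r)\<^sup>2 = r * (2 - r)" by (simp add: power2_eq_square algebra_simps)
      then have "1 / (1 - r)\<^sup>2 - 1 = r * (2 - r) / (1 - r)\<^sup>2"
        using r diff_divide_distrib[of 1 "(1 - r)\<^sup>2" "(1 - r)\<^sup>2"] by simp
      moreover have "r\<^sup>2 / (1 - r) = r\<^sup>2 * (1 - r) / (1 - r)\<^sup>2"
        using r by (simp add: power2_eq_square)
      ultimately have "r ^ k * (1 / (1 - r)\<^sup>2 - 1) + real k * r ^ (k-1) * (r\<^sup>2 / (1 - r))
         = (r ^ k * (r * (2 - r)) + real k * r ^ (k-1) * (r\<^sup>2 * (1 - r))) / (1 - r)\<^sup>2"
        by (simp add: add_divide_distrib)
      also have "r ^ k * (r * (2 - r)) + real k * r ^ (k-1) * (r\<^sup>2 * (1 - r))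
         = r ^ (k+1) * (2 - r + real k * (1 - r))"
        by (simp add: j algebra_simps power2_eq_square)
      finally show ?thesis .
    qed
    finally show ?thesis by (simp add: e_def c_def)
  qed
  \<comment> \<open>For k = 0 the factor \<open>of_nat 0\<close> removes the conjugate part together
    with the truncated exponent 0 - 1, so \<open>T 0\<close> is
    \<open>deriv (A 0) z * h\<close>.\<close>
  have "D h = T 0 + (\<Sum>k=1..p-1. T k)"
    unfolding D_def T_def by (simp add: sum.atLeast_Suc_atMost)
  then have Dh: "Re (cnj h * D h) = (norm h)\<^sup>2 * Re (deriv (A 0) z) + Re (cnj h * (\<Sum>k=1..p-1. T k))"
    unfolding cmod_power2 by (simp add: T_def algebra_simps power2_eq_square)
  have "\<Lambda> * ((1 - \<Lambda> * r) / (\<Lambda> - r)) \<le> Re (deriv (A 0) z)"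
    unfolding r_def by (rule bounded_imp_Re_ge[OF _ _ \<open>\<Lambda> > 1\<close> bd z])
      (use A1 hol in \<open>auto intro: holomorphic_deriv\<close>)
  then have analytic: "(norm h)\<^sup>2 * (\<Lambda> * ((1 - \<Lambda> * r) / (\<Lambda> - r))) \<le> (norm h)\<^sup>2 * Re (deriv (A 0) z)"
    by (intro mult_left_mono) auto
  have "\<bar>Re (cnj h * (\<Sum>k=1..p-1. T k))\<bar> \<le> (norm h)\<^sup>2 * (\<Sum>k=1..p-1. e k)"
  proof -
    have "norm (\<Sum>k=1..p-1. T k) \<le> (\<Sum>k=1..p-1. e k * norm h)" by (rule sum_norm_le) (rule T)
    then have "norm h * norm (\<Sum>k=1..p-1. T k) \<le> norm h * ((\<Sum>k=1..p-1. e k) * norm h)"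
      by (intro mult_left_mono) (auto simp: sum_distrib_right)
    moreover have "\<bar>Re (cnj h * (\<Sum>k=1..p-1. T k))\<bar> \<le> norm h * norm (\<Sum>k=1..p-1. T k)"
      using abs_Re_le_cmod[of "cnj h * (\<Sum>k=1..p-1. T k)"] by (simp only: norm_mult complex_mod_cnj)
    ultimately show ?thesis by (simp add: power2_eq_square mult_ac)
  qed
  then have rest: "- ((norm h)\<^sup>2 * (\<Sum>k=1..p-1. e k)) \<le> Re (cnj h * (\<Sum>k=1..p-1. T k))"
    by (metis abs_le_D2 minus_le_iff)
  have "rho_eqn p \<Lambda> M r = \<Lambda> * ((1 - \<Lambda> * r) / (\<Lambda> - r)) - (\<Sum>k=1..p-1. e k)"
    by (simp add: rho_eqn_def e_def sum.distrib)
  then have "rho_eqn p \<Lambda> M r * (norm h)\<^sup>2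
      = (norm h)\<^sup>2 * (\<Lambda> * ((1 - \<Lambda> * r) / (\<Lambda> - r))) - (norm h)\<^sup>2 * (\<Sum>k=1..p-1. e k)"
    by (simp only: right_diff_distrib mult.commute)
  also have "\<dots> \<le> Re (cnj h * D h)"
    using add_mono[OF analytic rest] unfolding Dh by (simp only: diff_conv_add_uminus)
  finally show "rho_eqn p \<Lambda> M (norm z) * (norm h)\<^sup>2 \<le> Re (cnj h * D h)"
    by (simp only: r_def)
qed

section \<open>The logarithm of f and the conclusion\<close>

text \<open>The difference takes values among the integer multiples of 2 pi i. These are at least 2
  pi apart, so it is constant on a connected set, and the common value at \<open>w\<close> makes the
  constant 0.\<close>

lemma continuous_log_unique:
  fixes F G :: "complex \<Rightarrow> complex"
  assumes "connected S" "continuous_on S F" "continuous_on S G"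
    and eq: "\<And>z. z \<in> S \<Longrightarrow> exp (F z) = exp (G z)" and "w \<in> S" "F w = G w" "z \<in> S"
  shows "F z = G z"
proof -
  have "(\<lambda>z. F z - G z) constant_on S"
  proof (rule continuous_discrete_range_constant[OF assms(1)])
    fix x assume x: "x \<in> S"
    have "2 * pi \<le> norm ((F y - G y) - (F x - G x))"
      if y: "y \<in> S" and ne: "F y - G y \<noteq> F x - G x" for y
    proof -
      define d where "d = (F y - G y) - (F x - G x)"
      have "exp d = 1" using eq[OF x] eq[OF y] by (simp add: d_def exp_diff)
      then obtain n :: int where n: "Im d = of_int (2 * n) * pi" "Re d = 0" by (auto simp: exp_eq_1)
      have "n \<noteq> 0" using n ne by (auto simp: d_def complex_eq_iff)
      then have "1 \<le> \<bar>real_of_int n\<bar>" by linarith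
      then have "2 * pi * 1 \<le> 2 * pi * \<bar>real_of_int n\<bar>" by (intro mult_left_mono) auto
      also have "\<dots> = \<bar>Im d\<bar>" by (simp add: n abs_mult)
      also have "\<dots> \<le> norm d" by (rule abs_Im_le_cmod)
      finally show ?thesis by (simp add: d_def)
    qed
    then show "\<exists>e>0. \<forall>y. y \<in> S \<and> F y - G y \<noteq> F x - G x \<longrightarrow> e \<le> norm ((F y - G y) - (F x - G x))"
      by (intro exI[of _ "2 * pi"]) auto
  qed (intro continuous_intros assms)
  then obtain c where "\<And>x. x \<in> S \<Longrightarrow> F x - G x = c" by (auto simp: constant_on_def)
  then show ?thesis using assms by (metis eq_iff_diff_eq_0)
qed

theorem theorem8:
  fixes p :: nat and \<Lambda> :: real and Mstar M :: "nat \<Rightarrow> real"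
    and a :: "nat \<Rightarrow> complex \<Rightarrow> complex" and f :: "complex \<Rightarrow> complex"
  assumes "p \<ge> 1" and "\<Lambda> > 1"
    and "\<And>k. k \<in> {1..p-1} \<Longrightarrow> Mstar k > 1"
    and "\<And>z. z \<in> ball 0 1 \<Longrightarrow> f z = (\<Prod>k=0..p-1. a k z powr (cnj z ^ k))"
    and "log_p_analytic p f (ball 0 1)"
    and "f 0 = 1" and "lambda_min f 0 = 1"
    and "\<And>k. k \<in> {0..p-1} \<Longrightarrow> log_p_analytic 1 (a k) (ball 0 1)"
    and "\<And>k. k \<in> {0..p-1} \<Longrightarrow> a k 0 = 1"
    and "\<And>k. k \<in> {0..p-1} \<Longrightarrow> deriv (a k) 0 = 1"
    and "\<And>k z. k \<in> {1..p-1} \<Longrightarrow> z \<in> ball 0 1 \<Longrightarrow> cmod (a k z) \<le> Mstar k"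
    and "\<And>z. z \<in> ball 0 1 \<Longrightarrow> cmod (deriv (\<lambda>w. Ln (a 0 w)) z) < \<Lambda>"
    and "\<And>k. k \<in> {1..p-1} \<Longrightarrow> M k = ln (Mstar k) + pi"
  shows "(\<exists>!\<rho>. 0 < \<rho> \<and> \<rho> < 1 \<and> rho_eqn p \<Lambda> M \<rho> = 0) \<and>
    (\<forall>\<rho> \<sigma>. 0 < \<rho> \<and> \<rho> < 1 \<and> rho_eqn p \<Lambda> M \<rho> = 0 \<and> \<sigma> = sigma_val p \<Lambda> M \<rho> \<longrightarrow>
       inj_on f (ball 0 \<rho>) \<and>
       schlicht_disk f (ball 0 \<rho>) (of_real (cosh \<sigma>)) (sinh \<sigma>))"
proof (intro conjI allI impI)
  have M_ge_1: "1 \<le> M k" if "k \<in> {1..p-1}" for k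
  proof -
    have "0 < ln (Mstar k)" using assms(3)[OF that] by simp
    then show ?thesis using assms(13)[OF that] pi_gt3 by linarith
  qed
  show "\<exists>!\<rho>. 0 < \<rho> \<and> \<rho> < 1 \<and> rho_eqn p \<Lambda> M \<rho> = 0"
    by (rule ex1_rho_eqn_root[OF \<open>\<Lambda> > 1\<close> M_ge_1])
  fix \<rho> \<sigma> assume root: "0 < \<rho> \<and> \<rho> < 1 \<and> rho_eqn p \<Lambda> M \<rho> = 0 \<and> \<sigma> = sigma_val p \<Lambda> M \<rho>"
  define A where "A = (\<lambda>k z. Ln (a k z))"
  define F where "F = (\<lambda>z. \<Sum>k=0..p-1. cnj z ^ k * A k z)"
  have a_nz: "a k z \<noteq> 0" if "k \<in> {0..p-1}" "norm z < 1" for k z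
    using assms(8)[OF that(1)] that(2) by (simp add: log_p_analytic_def)
  have hol: "A k holomorphic_on ball 0 1" if "k \<in> {0..p-1}" for k
    using assms(8)[OF that] poly_analytic_1_iff_holomorphic[of "ball 0 1" "A k"]
    by (simp add: log_p_analytic_def A_def)
  have A0: "A k 0 = 0" if "k \<in> {0..p-1}" for k
    using assms(9)[OF that] by (simp add: A_def)
  have A1: "deriv (A k) 0 = 1" if k: "k \<in> {0..p-1}" for k
  proof -
    \<comment> \<open>Holomorphy is given for \<open>A k\<close>, so differentiability of
      \<open>a k\<close> at 0 is recovered from a_k = exp A_k; as exp(A_k(0)) = 1, the two
      derivatives at 0 agree.\<close>
    have "((\<lambda>z. exp (A k z)) has_field_derivative exp (A k 0) * deriv (A k) 0) (at 0)"
      by (rule DERIV_chain2[OF DERIV_exp holomorphic_derivI[OF hol[OF k]]]) auto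
    then have "(a k has_field_derivative deriv (A k) 0) (at 0)"
      by (rule has_field_derivative_transform_within_open[where S = "ball 0 1", THEN DERIV_cong])
        (use a_nz[OF k] A0[OF k] in \<open>auto simp: A_def\<close>)
    then show ?thesis using assms(10)[OF k] by (simp add: DERIV_imp_deriv)
  qed
  have coeff: "norm ((deriv ^^ n) (A k) 0 / fact n) \<le> M k - 1 / M k" if k: "k \<in> {1..p-1}" and "n > 0" for k n
  proof -
    have k': "k \<in> {0..p-1}" using k by auto
    \<comment> \<open>The principal branch yields the half-strip: its real part is ln |a_k| and its
      imaginary part lies in (-pi, pi].\<close>
    have "norm ((deriv ^^ n) (A k) 0 / fact n) \<le> (ln (Mstar k) + pi) - 1 / (ln (Mstar k) + pi)"
    proof (rule half_strip_coeff_bound[OF hol[OF k'] A0[OF k'] \<open>n > 0\<close>])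
      show "0 < ln (Mstar k)" using assms(3)[OF k] by simp
      show "Re (A k z) \<le> ln (Mstar k)" if "norm z < 1" for z
        using assms(11)[OF k, of z] a_nz[OF k' that] that by (simp add: A_def ln_mono)
      show "\<bar>Im (A k z)\<bar> \<le> pi" if "norm z < 1" for z
        using mpi_less_Im_Ln[OF a_nz[OF k' that]] Im_Ln_le_pi[OF a_nz[OF k' that]] by (simp add: A_def)
    qed
    then show ?thesis using assms(13)[OF k] by simp
  qed
  have bd: "norm (deriv (A 0) z) < \<Lambda>" if "norm z < 1" for z
    using assms(12)[of z] that by (simp add: A_def)
  define F' where "F' = (\<lambda>z h. \<Sum>k=0..p-1. cnj z ^ k * (deriv (A k) z * h)
      + of_nat k * cnj h * cnj z ^ (k-1) * A k z)"
  have F': "(F has_derivative F' z) (at z)"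
    and F'_ge: "rho_eqn p \<Lambda> M (norm z) * (norm h)\<^sup>2 \<le> Re (cnj h * F' z h)"
    if "norm z < 1" for z h
    unfolding F_def F'_def
    using Re_derivative_polyanalytic_ge[of \<Lambda> p A M z, OF \<open>\<Lambda> > 1\<close> hol A0 A1 coeff bd that] by blast+
  have contF: "continuous_on (ball 0 1) F"
    using F' by (auto intro!: has_derivative_continuous continuous_at_imp_continuous_on)
  have F_0: "F 0 = 0" unfolding F_def using A0 by (intro sum.neutral) auto
  have exp_F: "exp (F z) = f z" if "norm z < 1" for z
    using assms(4)[of z] that a_nz by (simp add: F_def A_def exp_sum powr_def)
  have contLn: "continuous_on (ball 0 1) (\<lambda>z. Ln (f z))" and f_nz: "\<And>z. norm z < 1 \<Longrightarrow> f z \<noteq> 0"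
    using assms(5) by (auto simp: log_p_analytic_def poly_analytic_def)
  \<comment> \<open>A priori \<open>F z\<close> and the principal logarithm may differ by a multiple
    of 2 pi i. Continuity of \<open>Ln (f z)\<close>, contained in \<open>log_p_analytic\<close>,
    and the common value 0 at the origin exclude this, so injectivity of \<open>F\<close> passes to
    \<open>f\<close>.\<close>
  have Ln_f: "Ln (f z) = F z" if "norm z < 1" for z
    by (rule continuous_log_unique[of "ball 0 1" _ _ 0])
      (use that contF contLn f_nz exp_F F_0 assms(6) in auto)
  have \<rho>: "0 < \<rho>" "\<rho> < 1" "rho_eqn p \<Lambda> M \<rho> = 0" and \<sigma>: "\<sigma> = sigma_val p \<Lambda> M \<rho>" using root by auto
  have E_pos: "0 < rho_eqn p \<Lambda> M r" if "0 \<le> r" "r < \<rho>" for r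
    using rho_eqn_strict_antimono[of \<Lambda> p M r \<rho>] \<open>\<Lambda> > 1\<close> M_ge_1 \<rho> that by auto
  have inj_F: "inj_on F (ball 0 \<rho>)"
  proof (rule Re_derivative_pos_imp_inj_on)
    show "(F has_derivative F' z) (at z)" if "z \<in> ball 0 \<rho>" for z
      using F' that \<rho> by auto
    show "0 < Re (cnj h * F' z h)" if "z \<in> ball 0 \<rho>" "h \<noteq> 0" for z h
    proof -
      have "0 < rho_eqn p \<Lambda> M (norm z) * (norm h)\<^sup>2" using E_pos[of "norm z"] that by simp
      then show ?thesis using F'_ge[of z h] that \<rho> by auto
    qed
  qed auto
  show inj_f: "inj_on f (ball 0 \<rho>)"
  proof (rule inj_onI)
    fix x y assume "x \<in> ball 0 \<rho>" "y \<in> ball 0 \<rho>" "f x = f y"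
    moreover from this have "F x = F y" using Ln_f[of x] Ln_f[of y] \<rho> by simp
    ultimately show "x = y" using inj_F by (auto dest: inj_onD)
  qed
  \<comment> \<open>The rule for open intervals is used because the derivative
    \<open>rho_eqn\<close> vanishes at \<rho> itself.\<close>
  have "sigma_val p \<Lambda> M 0 < sigma_val p \<Lambda> M \<rho>"
  proof (rule DERIV_pos_imp_increasing_open[where f = "sigma_val p \<Lambda> M"])
    show "continuous_on {0..\<rho>} (sigma_val p \<Lambda> M)"
      by (intro continuous_at_imp_continuous_on ballI
          DERIV_isCont[OF sigma_val_has_derivative_rho_eqn[OF \<open>\<Lambda> > 1\<close>]]) (use \<rho> in auto)
    fix r assume r: "0 < r" "r < \<rho>"
    show "\<exists>y. (sigma_val p \<Lambda> M has_real_derivative y) (at r) \<and> 0 < y"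
      using sigma_val_has_derivative_rho_eqn[OF \<open>\<Lambda> > 1\<close>, of r p M] E_pos[of r] r \<rho>(2) by auto
  qed (rule \<rho>)
  then have "0 < \<sigma>" by (simp add: \<sigma> sigma_val_0)
  \<comment> \<open>Taking radius 1 rather than \<rho> includes the circle of radius \<rho>, where
    the covering argument needs the bound.\<close>
  have growth: "sigma_val p \<Lambda> M (norm z) \<le> norm (F z)" if "norm z < 1" for z
    by (rule Re_derivative_ge_imp_growth[where R = 1 and E = "rho_eqn p \<Lambda> M" and F' = F'])
      (use F' F'_ge sigma_val_has_derivative_rho_eqn[OF \<open>\<Lambda> > 1\<close>] F_0 sigma_val_0 that in blast)+
  have cover_F: "ball 0 \<sigma> \<subseteq> F ` ball 0 \<rho>"
  proof (rule ball_subset_image_if_inj_on[OF continuous_on_subset[OF contF] inj_F F_0])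
    show "\<sigma> \<le> norm (F z)" if "norm z = \<rho>" for z
      using growth[of z] that \<rho>(2) by (simp add: \<sigma>)
  qed (use \<rho> \<open>0 < \<sigma>\<close> in auto)
  show "schlicht_disk f (ball 0 \<rho>) (of_real (cosh \<sigma>)) (sinh \<sigma>)"
  proof (rule schlicht_disk_if_subset_image[OF _ _ inj_f])
    have "continuous_on (ball 0 \<rho>) (\<lambda>z. exp (F z))"
      by (intro continuous_on_exp continuous_on_subset[OF contF]) (use \<rho> in auto)
    then show "continuous_on (ball 0 \<rho>) f"
      by (rule continuous_on_eq) (use exp_F \<rho> in auto)
    show "ball (of_real (cosh \<sigma>)) (sinh \<sigma>) \<subseteq> f ` ball 0 \<rho>"
    proof
      fix w :: complex assume "w \<in> ball (of_real (cosh \<sigma>)) (sinh \<sigma>)"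
      note Lnw = norm_Ln_less_if_mem_ball_cosh[OF \<open>0 < \<sigma>\<close> this]
      then obtain z where z: "z \<in> ball 0 \<rho>" "Ln w = F z" using cover_F by auto
      then have "f z = w" using exp_F[of z] Lnw(1) \<rho> by (metis exp_Ln less_trans mem_ball_0)
      then show "w \<in> f ` ball 0 \<rho>" using z by blast
    qed
  qed (use \<open>0 < \<sigma>\<close> in auto)
qed

end
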